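(* Let $M\colon\mathbf{C}\to\mathbf{C}$ be a monad on a category $\mathbf{C}$ and $(T,\cdot,e)$ a monoid. Lawvere dynamical systems (indexed by $T$) in the Kleisli category of $M$ are exactly the $T$-graded coalgebras for the constantly-graded monad associated to $M$: for an object $X$ of $\mathbf{C}$, a family of $\mathbf{C}$-morphisms $(\gamma_t\colon X\to MX)_{t\in T}$, regarded as Kleisli endomorphisms of $X$, is a Lawvere dynamical system in the Kleisli category of $M$ if and only if it is a graded coalgebra for the $T$-graded monad with $M_t=M$ for all $t\in T$.
   Context: A Lawvere dynamical system in a category $\mathbf{D}$, indexed by a monoid $(T,\cdot,e)$, is a monoid homomorphism from $T$ to the monoid of endomorphisms of some object $X$ with composition in diagrammatic order; explicitly, a family of morphisms $\gamma_t\colon X\to X$ in $\mathbf{D}$ with $\gamma_e=\mathrm{id}_X$ and $\gamma_{s\cdot t}=\gamma_t\circ\gamma_s$ (first $\gamma_s$, then $\gamma_t$). For a monad $(M,\mu,\eta)$, the constantly-graded monad has $M_t=M$, $\mu^{s,t}=\mu\colon MM\to M$ for all $s,t\in T$, and unit $\eta$. A graded coalgebra of a $T$-graded monad $(M_t,\mu^{s,t},\eta)$ is an object $X$ with morphisms $\gamma_t\colon X\to M_tX$ ($t\in T$) such that $\gamma_e=\eta_X$ and $\gamma_{s\cdot t}=\mu^{s,t}_X\circ M_s\gamma_t\circ\gamma_s$ for all $s,t\in T$. *)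

theory Defs
  imports "HOL-Algebra.Group"
begin

text \<open>
  A category is given by a family of hom-sets indexed by pairs of objects. The hom-sets need not be
  pairwise disjoint, so composition carries its three objects:
  \<open>Comp C X Y Z g f\<close> is the composite ``first \<open>f \<in> Hom C X Y\<close>, then \<open>g \<in> Hom C Y Z\<close>''.
  For the same reason the arrow part of a functor carries the domain and codomain of its argument.
  Thus a morphism \<open>X \<rightarrow> M Y\<close> of a category can itself serve as a Kleisli morphism \<open>X \<rightarrow> Y\<close>.
\<close>

record ('o, 'm) category_data =
  Ob :: "'o set"
  Hom :: "'o \<Rightarrow> 'o \<Rightarrow> 'm set"
  Id :: "'o \<Rightarrow> 'm"
  Comp :: "'o \<Rightarrow> 'o \<Rightarrow> 'o \<Rightarrow> 'm \<Rightarrow> 'm \<Rightarrow> 'm"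

locale category =
  fixes C :: "('o, 'm) category_data"
  assumes Id_in_Hom: "X \<in> Ob C \<Longrightarrow> Id C X \<in> Hom C X X"
    and Comp_in_Hom: "\<lbrakk>X \<in> Ob C; Y \<in> Ob C; Z \<in> Ob C; f \<in> Hom C X Y; g \<in> Hom C Y Z\<rbrakk>
      \<Longrightarrow> Comp C X Y Z g f \<in> Hom C X Z"
    and Comp_Id_left: "\<lbrakk>X \<in> Ob C; Y \<in> Ob C; f \<in> Hom C X Y\<rbrakk> \<Longrightarrow> Comp C X Y Y (Id C Y) f = f"
    and Comp_Id_right: "\<lbrakk>X \<in> Ob C; Y \<in> Ob C; f \<in> Hom C X Y\<rbrakk> \<Longrightarrow> Comp C X X Y f (Id C X) = f"
    and Comp_assoc: "\<lbrakk>W \<in> Ob C; X \<in> Ob C; Y \<in> Ob C; Z \<in> Ob C;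
        f \<in> Hom C W X; g \<in> Hom C X Y; h \<in> Hom C Y Z\<rbrakk>
      \<Longrightarrow> Comp C W X Z (Comp C X Y Z h g) f = Comp C W Y Z h (Comp C W X Y g f)"

record ('o1, 'm1, 'o2, 'm2) functor_data =
  fob :: "'o1 \<Rightarrow> 'o2"
  fmor :: "'o1 \<Rightarrow> 'o1 \<Rightarrow> 'm1 \<Rightarrow> 'm2"

locale category_functor = C: category C + D: category D
  for C :: "('o1, 'm1) category_data" and D :: "('o2, 'm2) category_data" +
  fixes F :: "('o1, 'm1, 'o2, 'm2) functor_data"
  assumes fob_in_Ob: "X \<in> Ob C \<Longrightarrow> fob F X \<in> Ob D"
    and fmor_in_Hom: "\<lbrakk>X \<in> Ob C; Y \<in> Ob C; f \<in> Hom C X Y\<rbrakk>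
      \<Longrightarrow> fmor F X Y f \<in> Hom D (fob F X) (fob F Y)"
    and fmor_Id: "X \<in> Ob C \<Longrightarrow> fmor F X X (Id C X) = Id D (fob F X)"
    and fmor_Comp: "\<lbrakk>X \<in> Ob C; Y \<in> Ob C; Z \<in> Ob C; f \<in> Hom C X Y; g \<in> Hom C Y Z\<rbrakk>
      \<Longrightarrow> fmor F X Z (Comp C X Y Z g f)
        = Comp D (fob F X) (fob F Y) (fob F Z) (fmor F Y Z g) (fmor F X Y f)"

definition id_functor :: "('o, 'm, 'o, 'm) functor_data" where
  "id_functor = \<lparr>fob = \<lambda>X. X, fmor = \<lambda>X Y f. f\<rparr>"

definition comp_functor ::
  "('o2, 'm2, 'o3, 'm3) functor_data \<Rightarrow> ('o1, 'm1, 'o2, 'm2) functor_data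
    \<Rightarrow> ('o1, 'm1, 'o3, 'm3) functor_data" where
  "comp_functor G F =
    \<lparr>fob = \<lambda>X. fob G (fob F X), fmor = \<lambda>X Y f. fmor G (fob F X) (fob F Y) (fmor F X Y f)\<rparr>"

locale natural_trans = F: category_functor C D F + G: category_functor C D G
  for C :: "('o1, 'm1) category_data" and D :: "('o2, 'm2) category_data"
    and F G :: "('o1, 'm1, 'o2, 'm2) functor_data" +
  fixes \<alpha> :: "'o1 \<Rightarrow> 'm2"
  assumes component_in_Hom: "X \<in> Ob C \<Longrightarrow> \<alpha> X \<in> Hom D (fob F X) (fob G X)"
    and naturality: "\<lbrakk>X \<in> Ob C; Y \<in> Ob C; f \<in> Hom C X Y\<rbrakk>
      \<Longrightarrow> Comp D (fob F X) (fob F Y) (fob G Y) (\<alpha> Y) (fmor F X Y f)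
        = Comp D (fob F X) (fob G X) (fob G Y) (fmor G X Y f) (\<alpha> X)"

locale category_monad = M: category_functor C C M +
  mult: natural_trans C C "comp_functor M M" M \<mu> +
  unit: natural_trans C C id_functor M \<eta>
  for C :: "('o, 'm) category_data" and M :: "('o, 'm, 'o, 'm) functor_data"
    and \<mu> :: "'o \<Rightarrow> 'm" and \<eta> :: "'o \<Rightarrow> 'm" +
  assumes mult_assoc: "X \<in> Ob C \<Longrightarrow>
      Comp C (fob M (fob M (fob M X))) (fob M (fob M X)) (fob M X) (\<mu> X) (\<mu> (fob M X))
      = Comp C (fob M (fob M (fob M X))) (fob M (fob M X)) (fob M X)
          (\<mu> X) (fmor M (fob M (fob M X)) (fob M X) (\<mu> X))"
    and mult_unit_left: "X \<in> Ob C \<Longrightarrow>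
      Comp C (fob M X) (fob M (fob M X)) (fob M X) (\<mu> X) (\<eta> (fob M X)) = Id C (fob M X)"
    and mult_unit_right: "X \<in> Ob C \<Longrightarrow>
      Comp C (fob M X) (fob M (fob M X)) (fob M X) (\<mu> X) (fmor M X (fob M X) (\<eta> X))
      = Id C (fob M X)"

definition kleisli :: "('o, 'm) category_data \<Rightarrow> ('o, 'm, 'o, 'm) functor_data
    \<Rightarrow> ('o \<Rightarrow> 'm) \<Rightarrow> ('o \<Rightarrow> 'm) \<Rightarrow> ('o, 'm) category_data" where
  "kleisli C M \<mu> \<eta> =
    \<lparr>Ob = Ob C,
     Hom = \<lambda>X Y. Hom C X (fob M Y),
     Id = \<eta>,
     Comp = \<lambda>X Y Z g f.
       Comp C X (fob M (fob M Z)) (fob M Z) (\<mu> Z)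
         (Comp C X (fob M Y) (fob M (fob M Z)) (fmor M Y (fob M Z) g) f)\<rparr>"

definition endo_monoid :: "('o, 'm) category_data \<Rightarrow> 'o \<Rightarrow> 'm monoid" where
  \<comment> \<open>The multiplication is composition in diagrammatic order: first \<open>f\<close>, then \<open>g\<close>.\<close>
  "endo_monoid D X =
    \<lparr>carrier = Hom D X X, monoid.mult = \<lambda>f g. Comp D X X X g f, one = Id D X\<rparr>"

definition monoid_hom :: "('a, 'x) monoid_scheme \<Rightarrow> ('b, 'y) monoid_scheme \<Rightarrow> ('a \<Rightarrow> 'b) set" where
  \<comment> \<open>The set \<^const>\<open>hom\<close> does not require preservation of the unit, which is not automatic for monoids.\<close>
  "monoid_hom G H = {h \<in> hom G H. h \<one>\<^bsub>G\<^esub> = \<one>\<^bsub>H\<^esub>}"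

locale lawvere_dynamical_system = T: monoid T + D: category D
  for T :: "('t, 'x) monoid_scheme" (structure) and D :: "('o, 'm) category_data" +
  fixes X :: 'o and \<gamma> :: "'t \<Rightarrow> 'm"
  assumes in_Ob: "X \<in> Ob D"
    and monoid_hom: "\<gamma> \<in> monoid_hom T (endo_monoid D X)"

text \<open>
  A graded monad is a lax monoidal functor from \<open>T\<close>, as a discrete monoidal category, to the
  endofunctors of \<open>C\<close>, with \<open>\<mu> s t : M\<^sub>s M\<^sub>t \<rightarrow> M\<^sub>s\<^sub>t\<close> and \<open>\<eta> : Id \<rightarrow> M\<^sub>e\<close>.
\<close>

locale graded_monad = C: category C + T: monoid T
  for C :: "('o, 'm) category_data" and T :: "('t, 'x) monoid_scheme" (structure) +
  fixes M :: "'t \<Rightarrow> ('o, 'm, 'o, 'm) functor_data"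
    and \<mu> :: "'t \<Rightarrow> 't \<Rightarrow> 'o \<Rightarrow> 'm"
    and \<eta> :: "'o \<Rightarrow> 'm"
  assumes functor_M: "t \<in> carrier T \<Longrightarrow> category_functor C C (M t)"
    and natural_mult: "\<lbrakk>s \<in> carrier T; t \<in> carrier T\<rbrakk>
      \<Longrightarrow> natural_trans C C (comp_functor (M s) (M t)) (M (s \<otimes> t)) (\<mu> s t)"
    and natural_unit: "natural_trans C C id_functor (M \<one>) \<eta>"
    and mult_assoc: "\<lbrakk>s \<in> carrier T; t \<in> carrier T; u \<in> carrier T; X \<in> Ob C\<rbrakk> \<Longrightarrow>
      Comp C (fob (M s) (fob (M t) (fob (M u) X))) (fob (M (s \<otimes> t)) (fob (M u) X))
          (fob (M (s \<otimes> t \<otimes> u)) X)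
        (\<mu> (s \<otimes> t) u X) (\<mu> s t (fob (M u) X))
      = Comp C (fob (M s) (fob (M t) (fob (M u) X))) (fob (M s) (fob (M (t \<otimes> u)) X))
          (fob (M (s \<otimes> (t \<otimes> u))) X)
        (\<mu> s (t \<otimes> u) X) (fmor (M s) (fob (M t) (fob (M u) X)) (fob (M (t \<otimes> u)) X) (\<mu> t u X))"
    and mult_unit_left: "\<lbrakk>t \<in> carrier T; X \<in> Ob C\<rbrakk> \<Longrightarrow>
      Comp C (fob (M t) X) (fob (M \<one>) (fob (M t) X)) (fob (M t) X)
        (\<mu> \<one> t X) (\<eta> (fob (M t) X))
      = Id C (fob (M t) X)"
    and mult_unit_right: "\<lbrakk>t \<in> carrier T; X \<in> Ob C\<rbrakk> \<Longrightarrow>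
      Comp C (fob (M t) X) (fob (M t) (fob (M \<one>) X)) (fob (M t) X)
        (\<mu> t \<one> X) (fmor (M t) X (fob (M \<one>) X) (\<eta> X))
      = Id C (fob (M t) X)"

locale graded_coalgebra = graded_monad C T M \<mu> \<eta>
  for C :: "('o, 'm) category_data" and T :: "('t, 'x) monoid_scheme" (structure)
    and M :: "'t \<Rightarrow> ('o, 'm, 'o, 'm) functor_data"
    and \<mu> :: "'t \<Rightarrow> 't \<Rightarrow> 'o \<Rightarrow> 'm"
    and \<eta> :: "'o \<Rightarrow> 'm" +
  fixes X :: 'o and \<gamma> :: "'t \<Rightarrow> 'm"
  assumes in_Ob: "X \<in> Ob C"
    and in_Hom: "t \<in> carrier T \<Longrightarrow> \<gamma> t \<in> Hom C X (fob (M t) X)"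
    and at_one: "\<gamma> \<one> = \<eta> X"
    and at_mult: "\<lbrakk>s \<in> carrier T; t \<in> carrier T\<rbrakk> \<Longrightarrow>
      \<gamma> (s \<otimes> t)
      = Comp C X (fob (M s) (fob (M t) X)) (fob (M (s \<otimes> t)) X) (\<mu> s t X)
          (Comp C X (fob (M s) X) (fob (M s) (fob (M t) X))
            (fmor (M s) X (fob (M t) X) (\<gamma> t)) (\<gamma> s))"

definition const_graded_functor ::
  "('o, 'm, 'o, 'm) functor_data \<Rightarrow> 't \<Rightarrow> ('o, 'm, 'o, 'm) functor_data" where
  "const_graded_functor M t = M"

definition const_graded_mult :: "('o \<Rightarrow> 'm) \<Rightarrow> 't \<Rightarrow> 't \<Rightarrow> 'o \<Rightarrow> 'm" where
  "const_graded_mult \<mu> s t = \<mu>"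

end

theory Submission
  imports Defs
begin

text \<open>The Kleisli composite of \<open>\<gamma> s\<close> followed by \<open>\<gamma> t\<close>
  is \<open>\<mu> X\<close> after M(\<open>\<gamma> t\<close>) after \<open>\<gamma> s\<close>, and
  the Kleisli identity is \<open>\<eta> X\<close>. So the homomorphism law into the Kleisli
  endomorphisms, read in diagrammatic order, is literally the coalgebra law once the grading is
  constant; nothing has to be computed there. Each notion also carries a structural claim: that the
  Kleisli data form a category (\<open>category_kleisli\<close>) and that the constant grading is a
  graded monad (\<open>graded_monad_const\<close>). The work lies in these, chiefly in Kleisli
  associativity.\<close>

context category_monad
begin

lemmas ob_simps [simp] = M.fob_in_Ob
lemmas hom_simps [simp] = M.C.Id_in_Hom M.fmor_in_Hom

lemma mult_in_Hom [simp]: "X \<in> Ob C \<Longrightarrow> \<mu> X \<in> Hom C (fob M (fob M X)) (fob M X)"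
  using mult.component_in_Hom[of X] by (simp add: comp_functor_def)

lemma unit_in_Hom [simp]: "X \<in> Ob C \<Longrightarrow> \<eta> X \<in> Hom C X (fob M X)"
  using unit.component_in_Hom[of X] by (simp add: id_functor_def)

lemma mult_naturality:
  "\<lbrakk>X \<in> Ob C; Y \<in> Ob C; f \<in> Hom C X Y\<rbrakk> \<Longrightarrow>
    Comp C (fob M (fob M X)) (fob M (fob M Y)) (fob M Y) (\<mu> Y)
      (fmor M (fob M X) (fob M Y) (fmor M X Y f))
    = Comp C (fob M (fob M X)) (fob M X) (fob M Y) (fmor M X Y f) (\<mu> X)"
  using mult.naturality[of X Y f] by (simp add: comp_functor_def)

lemma unit_naturality:
  "\<lbrakk>X \<in> Ob C; Y \<in> Ob C; f \<in> Hom C X Y\<rbrakk> \<Longrightarrow>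
    Comp C X Y (fob M Y) (\<eta> Y) f = Comp C X (fob M X) (fob M Y) (fmor M X Y f) (\<eta> X)"
  using unit.naturality[of X Y f] by (simp add: id_functor_def)

text \<open>The unit laws come from the monad unit laws, with naturality of \<open>\<eta>\<close>
  for one of them; associativity comes from \<open>mult_assoc\<close> and naturality of
  \<open>\<mu>\<close>.\<close>

lemma category_kleisli: "category (kleisli C M \<mu> \<eta>)"
proof
  fix X assume "X \<in> Ob (kleisli C M \<mu> \<eta>)"
  then show "Id (kleisli C M \<mu> \<eta>) X \<in> Hom (kleisli C M \<mu> \<eta>) X X"
    by (simp add: kleisli_def)
next
  fix X Y Z f g
  assume "X \<in> Ob (kleisli C M \<mu> \<eta>)" "Y \<in> Ob (kleisli C M \<mu> \<eta>)" "Z \<in> Ob (kleisli C M \<mu> \<eta>)"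
    "f \<in> Hom (kleisli C M \<mu> \<eta>) X Y" "g \<in> Hom (kleisli C M \<mu> \<eta>) Y Z"
  then show "Comp (kleisli C M \<mu> \<eta>) X Y Z g f \<in> Hom (kleisli C M \<mu> \<eta>) X Z"
    by (auto simp: kleisli_def intro!: M.C.Comp_in_Hom[where Y = "fob M (fob M Z)"]
        M.C.Comp_in_Hom[where Y = "fob M Y"])
next
  fix X Y f
  assume "X \<in> Ob (kleisli C M \<mu> \<eta>)" "Y \<in> Ob (kleisli C M \<mu> \<eta>)"
    "f \<in> Hom (kleisli C M \<mu> \<eta>) X Y"
  then have [simp]: "X \<in> Ob C" "Y \<in> Ob C" "f \<in> Hom C X (fob M Y)"
    by (auto simp: kleisli_def)
  \<comment> \<open>Sides swap: post-composing with the Kleisli identity applies M to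
    \<open>\<eta> Y\<close>, so this is the right unit law of the monad.\<close>
  have "Comp (kleisli C M \<mu> \<eta>) X Y Y (\<eta> Y) f
      = Comp C X (fob M Y) (fob M Y)
          (Comp C (fob M Y) (fob M (fob M Y)) (fob M Y) (\<mu> Y) (fmor M Y (fob M Y) (\<eta> Y))) f"
    by (simp add: kleisli_def M.C.Comp_assoc)
  then show "Comp (kleisli C M \<mu> \<eta>) X Y Y (Id (kleisli C M \<mu> \<eta>) Y) f = f"
    by (simp add: kleisli_def mult_unit_right M.C.Comp_Id_left)
  \<comment> \<open>Naturality of \<open>\<eta>\<close> at \<open>f\<close> trades M\<open>f\<close>
    after \<open>\<eta> X\<close> for \<open>\<eta> (fob M Y)\<close> after
    \<open>f\<close>.\<close>
  have "Comp (kleisli C M \<mu> \<eta>) X X Y f (\<eta> X)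
      = Comp C X (fob M Y) (fob M Y)
          (Comp C (fob M Y) (fob M (fob M Y)) (fob M Y) (\<mu> Y) (\<eta> (fob M Y))) f"
    by (simp add: kleisli_def M.C.Comp_assoc unit_naturality[of X "fob M Y"])
  then show "Comp (kleisli C M \<mu> \<eta>) X X Y f (Id (kleisli C M \<mu> \<eta>) X) = f"
    by (simp add: kleisli_def mult_unit_left M.C.Comp_Id_left)
next
  fix W X Y Z f g h
  assume "W \<in> Ob (kleisli C M \<mu> \<eta>)" "X \<in> Ob (kleisli C M \<mu> \<eta>)"
    "Y \<in> Ob (kleisli C M \<mu> \<eta>)" "Z \<in> Ob (kleisli C M \<mu> \<eta>)"
    "f \<in> Hom (kleisli C M \<mu> \<eta>) W X" "g \<in> Hom (kleisli C M \<mu> \<eta>) X Y"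
    "h \<in> Hom (kleisli C M \<mu> \<eta>) Y Z"
  then have [simp]: "W \<in> Ob C" "X \<in> Ob C" "Y \<in> Ob C" "Z \<in> Ob C"
    "f \<in> Hom C W (fob M X)" "g \<in> Hom C X (fob M Y)" "h \<in> Hom C Y (fob M Z)"
    by (auto simp: kleisli_def)
  let ?M = "fob M" and ?K = "kleisli C M \<mu> \<eta>"
  let ?h = "fmor M Y (?M Z) h" and ?g = "fmor M X (?M Y) g"
  let ?hh = "fmor M (?M Y) (?M (?M Z)) ?h"
  \<comment> \<open>Both bracketings begin with this composite; only what follows it
    differs.\<close>
  define k where "k = Comp C W (?M X) (?M (?M Y)) ?g f"
  have k [simp]: "k \<in> Hom C W (?M (?M Y))"
    by (auto simp: k_def intro!: M.C.Comp_in_Hom[where Y = "?M X"])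
  have hg [simp]: "Comp C X (?M Y) (?M (?M Z)) ?h g \<in> Hom C X (?M (?M Z))"
    by (rule M.C.Comp_in_Hom) auto
  have hhk [simp]: "Comp C W (?M (?M Y)) (?M (?M (?M Z))) ?hh k \<in> Hom C W (?M (?M (?M Z)))"
    by (rule M.C.Comp_in_Hom) auto
  have hhg [simp]: "Comp C (?M X) (?M (?M Y)) (?M (?M (?M Z))) ?hh ?g
      \<in> Hom C (?M X) (?M (?M (?M Z)))"
    by (rule M.C.Comp_in_Hom) auto
  \<comment> \<open>Functoriality splits M applied to the inner Kleisli composite into three
    factors.\<close>
  have "Comp ?K W X Z (Comp ?K X Y Z h g) f
      = Comp C W (?M (?M Z)) (?M Z) (\<mu> Z)
          (Comp C W (?M (?M (?M Z))) (?M (?M Z)) (fmor M (?M (?M Z)) (?M Z) (\<mu> Z))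
            (Comp C W (?M (?M Y)) (?M (?M (?M Z))) ?hh k))"
    by (simp add: kleisli_def k_def M.fmor_Comp M.C.Comp_assoc)
  also have "\<dots> = Comp C W (?M (?M Z)) (?M Z) (\<mu> Z)
          (Comp C W (?M (?M (?M Z))) (?M (?M Z)) (\<mu> (?M Z))
            (Comp C W (?M (?M Y)) (?M (?M (?M Z))) ?hh k))"
    \<comment> \<open>Fixing the middle object regroups exactly at the two multiplications, where
      \<open>mult_assoc\<close> applies.\<close>
    by (simp add: M.C.Comp_assoc[symmetric, where Y = "?M (?M Z)"] mult_assoc)
  also have "\<dots> = Comp C W (?M (?M Z)) (?M Z) (\<mu> Z)
          (Comp C W (?M Y) (?M (?M Z)) ?h (Comp C W (?M (?M Y)) (?M Y) (\<mu> Y) k))"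
    \<comment> \<open>Splitting off \<open>k\<close> exposes the naturality square of
      \<open>\<mu>\<close> at \<open>h\<close>.\<close>
    by (simp add: M.C.Comp_assoc[symmetric, where W = W and X = "?M (?M Y)"] mult_naturality)
  also have "\<dots> = Comp ?K W Y Z h (Comp ?K W X Y g f)"
    by (simp add: kleisli_def k_def)
  finally show "Comp ?K W X Z (Comp ?K X Y Z h g) f = Comp ?K W Y Z h (Comp ?K W X Y g f)" .
qed

text \<open>With the grades erased, each graded law is the monad law of the same shape.\<close>

lemma graded_monad_const:
  assumes "monoid T"
  shows "graded_monad C T (const_graded_functor M) (const_graded_mult \<mu>) \<eta>"
  unfolding graded_monad_def graded_monad_axioms_def
  by (auto simp: const_graded_functor_def const_graded_mult_def assms M.C.category_axioms
      M.category_functor_axioms mult.natural_trans_axioms unit.natural_trans_axioms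
      mult_assoc mult_unit_left mult_unit_right)

end

theorem proposition2p12:
  fixes C :: "('o, 'm) category_data"
    and M :: "('o, 'm, 'o, 'm) functor_data"
    and \<mu> \<eta> :: "'o \<Rightarrow> 'm"
    and T :: "('t, 'x) monoid_scheme"
    and X :: 'o
    and \<gamma> :: "'t \<Rightarrow> 'm"
  assumes "category_monad C M \<mu> \<eta>"
    and "monoid T"
    and "X \<in> Ob C"
    and "\<forall>t\<in>carrier T. \<gamma> t \<in> Hom C X (fob M X)"
  shows "lawvere_dynamical_system T (kleisli C M \<mu> \<eta>) X \<gamma>
    \<longleftrightarrow> graded_coalgebra C T (const_graded_functor M) (const_graded_mult \<mu>) \<eta> X \<gamma>"
proof -
  interpret category_monad C M \<mu> \<eta> by fact
  \<comment> \<open>Only the conditions on \<open>X\<close> and \<open>\<gamma>\<close> are compared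
    here; the structural premises are discharged afterwards.\<close>
  have "lawvere_dynamical_system_axioms T (kleisli C M \<mu> \<eta>) X \<gamma>
    \<longleftrightarrow> graded_coalgebra_axioms C T (const_graded_functor M) (const_graded_mult \<mu>) \<eta> X \<gamma>"
    using assms(3,4)
    by (auto simp: lawvere_dynamical_system_axioms_def graded_coalgebra_axioms_def monoid_hom_def
        hom_def endo_monoid_def kleisli_def const_graded_functor_def const_graded_mult_def)
  then show ?thesis
    using category_kleisli graded_monad_const[OF assms(2)] assms(2)
    by (simp add: lawvere_dynamical_system_def graded_coalgebra_def)
qed

end
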